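(* Let $s\ge 1$ and $q$ be integers with $0\le q\le s$, and let $n=T_s+q$. Then the maximal vertex degree $\Delta_n$ of the partition graph $G_n$ is $$\Delta_n=s(s-1)+\rho(q),$$ where $\rho(q):=\max\{a+b:\ a,b\in\mathbb Z_{\ge 0},\ T_a+T_b\le q\}$. Equivalently, $$\Delta_n=s(s-1)+\left\lfloor\sqrt{4q+1}\right\rfloor-1.$$
   Context: For an integer $m\ge 0$, $T_m:=m(m+1)/2$. Every positive integer $n$ is uniquely of the form $n=T_s+q$ with $s\ge 1$, $0\le q\le s$. Partition graph: for $n\ge 1$, $G_n$ is the simple graph whose vertices are the integer partitions of $n$; two distinct partitions are adjacent if one is obtained from the other by an elementary transfer of one unit from one part to another (subtract $1$ from one part and add $1$ to another part), followed by reordering. Here the receiving part may be a zero part (so a new part $1$ may be created), and parts that become $0$ are discarded. $\deg(\lambda)$ is the degree of $\lambda$ in $G_n$, and $\Delta_n:=\max_{\lambda\vdash n}\deg(\lambda)$. *)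

theory Defs
  imports Complex_Main "HOL-Library.Multiset" "HOL-Library.Nat_Bijection"
    "Graph_Theory.Pair_Digraph"
begin

definition partitions :: "nat \<Rightarrow> nat multiset set" where
  "partitions n = {p. 0 \<notin># p \<and> sum_mset p = n}"

text \<open>Move one unit from a part \<open>x\<close> to a part \<open>y\<close>. For \<open>y = 0\<close> a new part \<open>1\<close> is created:
  a partition does not contain \<open>0\<close>, so subtracting the second element has no effect.\<close>

definition transfer :: "nat multiset \<Rightarrow> nat \<Rightarrow> nat \<Rightarrow> nat multiset" where
  "transfer p x y = filter_mset (\<lambda>i. 0 < i) (p - {#x, y#} + {#x - 1, y + 1#})"

text \<open>The receiving part \<open>y\<close> is a different occurrence from the giving part \<open>x\<close>
  (the values may coincide), or a zero part.\<close>

definition is_transfer :: "nat multiset \<Rightarrow> nat multiset \<Rightarrow> bool" where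
  "is_transfer p r \<longleftrightarrow> (\<exists>x y. x \<in># p \<and> y \<in># add_mset 0 (p - {#x#}) \<and> r = transfer p x y)"

text \<open>As usual in \<open>Graph_Theory\<close>, a simple graph is a loop-free symmetric digraph; the degree
  of a vertex is then its out-degree.\<close>

definition partition_graph :: "nat \<Rightarrow> nat multiset pair_pre_digraph" where
  "partition_graph n =
    \<lparr> pverts = partitions n,
      parcs = {(p, r). p \<in> partitions n \<and> r \<in> partitions n \<and> p \<noteq> r \<and>
                       (is_transfer p r \<or> is_transfer r p)} \<rparr>"

lemma finite_partitions: "finite (partitions n)"
proof (rule finite_subset)
  show "partitions n \<subseteq> mset ` {xs. set xs \<subseteq> {..n} \<and> length xs \<le> n}"
  proof
    fix p assume p: "p \<in> partitions n"
    obtain xs where xs: "p = mset xs" by (metis ex_mset)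
    have s: "sum_list xs = n" and z: "0 \<notin> set xs"
      using p by (auto simp: xs partitions_def sum_mset_sum_list)
    have "length xs \<le> sum_list xs"
      using z by (induction xs) auto
    moreover have "set xs \<subseteq> {..n}"
      using s member_le_sum_list by fastforce
    ultimately show "p \<in> mset ` {xs. set xs \<subseteq> {..n} \<and> length xs \<le> n}"
      using xs s by auto
  qed
  show "finite (mset ` {xs. set xs \<subseteq> {..n} \<and> length xs \<le> n})"
    by (intro finite_imageI finite_lists_length_le) simp
qed

lemma partition_graph: "pair_graph (partition_graph n)"
proof -
  have "finite (parcs (partition_graph n))"
    by (rule finite_subset[of _ "partitions n \<times> partitions n"])
      (auto simp: partition_graph_def finite_partitions)
  then show ?thesis
    by unfold_locales (auto simp: partition_graph_def finite_partitions sym_def symmetric_def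
      arcs_ends_def arc_to_ends_def image_iff)
qed

text \<open>Sanity check: transfers preserve \<open>n\<close>, so the restriction of the arcs to
  \<^term>\<open>partitions n\<close> discards nothing.\<close>

lemma is_transfer_partitions:
  assumes "p \<in> partitions n" "is_transfer p r"
  shows "r \<in> partitions n"
proof -
  have pos: "sum_mset (filter_mset (\<lambda>i. 0 < i) m) = sum_mset m" for m :: "nat multiset"
    by (induction m) auto
  from assms(2) obtain x y where x: "x \<in># p" and y: "y \<in># add_mset 0 (p - {#x#})"
    and r: "r = transfer p x y" by (auto simp: is_transfer_def)
  from x obtain q where q: "p = add_mset x q" by (metis mset_add)
  have "x > 0" using x assms(1) by (auto simp: partitions_def intro: gr0I)
  have "sum_mset r = n"
  proof (cases "y \<in># q")
    case True
    then obtain q' where "q = add_mset y q'" by (metis mset_add)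
    then show ?thesis using assms(1) \<open>x > 0\<close>
      by (simp add: r q transfer_def pos partitions_def del: filter_union_mset filter_mset_add_mset)
  next
    case False
    then have "y = 0" "q - {#y#} = q" using y q by (auto simp: diff_single_trivial)
    then show ?thesis using assms(1) \<open>x > 0\<close>
      by (simp add: r q transfer_def pos partitions_def del: filter_union_mset filter_mset_add_mset)
  qed
  moreover have "0 \<notin># r" by (simp only: r transfer_def set_mset_filter) simp
  ultimately show ?thesis by (simp add: partitions_def)
qed

definition partition_degree :: "nat \<Rightarrow> nat multiset \<Rightarrow> nat" where
  "partition_degree n p = out_degree (with_proj (partition_graph n)) p"

definition max_degree :: "nat \<Rightarrow> nat" where
  "max_degree n = Max (partition_degree n ` partitions n)"

definition rho :: "nat \<Rightarrow> nat" where
  "rho q = Max {a + b | a b. triangle a + triangle b \<le> q}"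

text \<open>\<^const>\<open>Max\<close> is only meaningful on finite sets.\<close>

lemma finite_rho: "finite {a + b | a b. triangle a + triangle b \<le> q}"
proof (rule finite_subset)
  have le: "m \<le> triangle m" for m by (induction m) auto
  show "{a + b | a b. triangle a + triangle b \<le> q} \<subseteq> {..q}"
  proof clarsimp
    fix a b assume "triangle a + triangle b \<le> q"
    then show "a + b \<le> q" using le[of a] le[of b] by linarith
  qed
qed simp

end

theory Submission
  imports Defs
begin

text \<open>A partition with \<open>k\<close> distinct part sizes, of which \<open>a\<close> are at least \<open>2\<close> above the next
  smaller size (or \<open>0\<close>) and \<open>b\<close> are repeated, has degree \<open>k (k - 1) + a + b\<close>: of the
  \<open>k (k + 1)\<close> pairs (giving size, receiving size), only the transfers from \<open>x\<close> to \<open>x - 1\<close> and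
  those from a non-repeated size to itself have to be left out. The sum of such a partition is
  at least \<open>triangle k + triangle a + triangle b\<close>, and for \<open>k = s\<close> every such bound can be met.
  For \<open>k < s\<close> the degree is at most \<open>k (k + 1) \<le> s (s - 1)\<close>, as \<open>a, b \<le> k\<close>.\<close>

section \<open>The degree of a partition\<close>

text \<open>The untouched parts \<open>w\<close> are split off, and the filter absorbs zero parts on
  both sides. In this form, replacing \<open>(x, y)\<close> by \<open>(y + 1, x - 1)\<close> swaps
  \<open>p\<close> and \<open>r\<close>.\<close>

lemma is_transfer_iff:
  assumes "0 \<notin># p"
  shows "is_transfer p r \<longleftrightarrow> (\<exists>x y w. 0 < x \<and> 0 \<notin># w \<and>
    p = filter_mset ((<) 0) {#x, y#} + w \<and> r = filter_mset ((<) 0) {#x - 1, y + 1#} + w)"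
    (is "_ \<longleftrightarrow> ?R")
proof
  assume "is_transfer p r"
  then obtain x y where x: "x \<in># p" and y: "y \<in># add_mset 0 (p - {#x#})"
    and r: "r = transfer p x y" by (auto simp: is_transfer_def)
  have x0: "0 < x" using x assms by (auto intro: gr0I)
  from x obtain v where v: "p = add_mset x v" by (metis mset_add)
  have v0: "filter_mset ((<) 0) v = v" "0 \<notin># v"
    using assms by (auto simp: v filter_mset_eq_conv intro: gr0I)
  show ?R
  proof (cases "y = 0")
    case True
    have "v - {#0#} = v" using v0 by (simp add: diff_single_trivial)
    then show ?thesis using x0 v0
      by (intro exI[of _ x] exI[of _ 0] exI[of _ v]) (auto simp: r v True transfer_def)
  next
    case False
    then obtain w where w: "v = add_mset y w" using y v
      by (metis add_mset_remove_trivial insert_iff mset_add set_mset_add_mset_insert)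
    have "filter_mset ((<) 0) w = w" "0 \<notin># w"
      using assms by (auto simp: v w filter_mset_eq_conv intro: gr0I)
    then show ?thesis using x0 False
      by (intro exI[of _ x] exI[of _ y] exI[of _ w]) (auto simp: r v w transfer_def)
  qed
next
  assume ?R
  then obtain x y w where x: "0 < x" and w: "0 \<notin># w"
    and p: "p = filter_mset ((<) 0) {#x, y#} + w"
    and r: "r = filter_mset ((<) 0) {#x - 1, y + 1#} + w" by blast
  have f: "filter_mset ((<) 0) w = w" using w by (auto simp: filter_mset_eq_conv intro: gr0I)
  have "p - {#x, y#} = w"
    using x w by (cases "y = 0") (auto simp: p diff_single_trivial)
  then have "r = transfer p x y" using f by (simp add: transfer_def r)
  moreover have "x \<in># p" "y \<in># add_mset 0 (p - {#x#})"
    using x by (auto simp: p)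
  ultimately show "is_transfer p r" by (auto simp: is_transfer_def)
qed

lemma is_transfer_sym:
  assumes "0 \<notin># p" "is_transfer p r"
  shows "is_transfer r p"
proof -
  obtain x y w where *: "0 < x" "0 \<notin># w"
    "p = filter_mset ((<) 0) {#x, y#} + w" "r = filter_mset ((<) 0) {#x - 1, y + 1#} + w"
    using assms is_transfer_iff by blast
  then have "0 \<notin># r" by auto
  from * show ?thesis
    unfolding is_transfer_iff[OF \<open>0 \<notin># r\<close>]
    by (intro exI[of _ "y + 1"] exI[of _ "x - 1"] exI[of _ w]) (auto simp: add_mset_commute)
qed

text \<open>In terms of the conjugate partition, a transfer from \<open>x\<close> to \<open>y\<close> moves a unit from the
  part with index \<open>x\<close> to the part with index \<open>y + 1\<close>; hence different transfers have
  different results.\<close>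

lemma conjugate_transfer:
  fixes i :: nat
  assumes "0 \<notin># p" "x \<in># p" "y \<in># add_mset 0 (p - {#x#})" "0 < i"
  shows "size (filter_mset ((\<le>) i) (transfer p x y)) + of_bool (i = x) =
    size (filter_mset ((\<le>) i) p) + of_bool (i = y + 1)"
proof -
  have x0: "0 < x" using assms by (auto intro: gr0I)
  have ff: "filter_mset ((\<le>) i) (filter_mset ((<) 0) m) = filter_mset ((\<le>) i) m" for m
    using \<open>0 < i\<close> by (auto simp: filter_filter_mset intro!: filter_mset_cong)
  obtain v where v: "p = add_mset x v" using assms by (metis mset_add)
  show ?thesis
  proof (cases "y = 0")
    case True
    have "v - {#0#} = v" using assms(1) by (simp add: v diff_single_trivial)
    then show ?thesis using x0 assms(4)
      by (auto simp: v True transfer_def ff simp del: filter_union_mset filter_mset_add_mset)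
        (auto)
  next
    case False
    then obtain w where w: "v = add_mset y w" using assms(3) v
      by (metis add_mset_remove_trivial insert_iff mset_add set_mset_add_mset_insert)
    show ?thesis using x0 assms(4)
      by (auto simp: v w transfer_def ff simp del: filter_union_mset filter_mset_add_mset)
        (auto)
  qed
qed

text \<open>Sizes, not occurrences, since equal parts yield the same result. The case
  \<open>x = y + 1\<close> is left out because such a transfer gives back \<open>p\<close>.\<close>

definition transfer_pairs :: "nat multiset \<Rightarrow> (nat \<times> nat) set" where
  "transfer_pairs p = {(x, y). x \<in># p \<and> y \<in># add_mset 0 (p - {#x#}) \<and> x \<noteq> y + 1}"

lemma inj_on_transfer:
  assumes "0 \<notin># p"
  shows "inj_on (\<lambda>(x, y). transfer p x y) (transfer_pairs p)"
proof (rule inj_onI, clarsimp)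
  fix x y x' y'
  assume a: "(x, y) \<in> transfer_pairs p" "(x', y') \<in> transfer_pairs p"
    and eq: "transfer p x y = transfer p x' y'"
  have "0 < x" "0 < x'" using a assms by (auto simp: transfer_pairs_def intro: gr0I)
  \<comment> \<open>Both results have the same conjugate, so comparing the two instances of
    \<open>conjugate_transfer\<close> leaves only the indicators. At \<open>i = x\<close>, the
    inequality \<open>x \<noteq> y + 1\<close> then forces \<open>x = x'\<close>.\<close>
  have c: "of_bool (i = x) + of_bool (i = y' + 1) = (of_bool (i = x') + of_bool (i = y + 1) :: nat)"
    if "0 < i" for i
    using conjugate_transfer[OF assms _ _ that, of x y] conjugate_transfer[OF assms _ _ that, of x' y']
      a eq by (auto simp: transfer_pairs_def)
  have "x = x'" using c[of x] a \<open>0 < x\<close>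
    by (auto simp: transfer_pairs_def of_bool_def split: if_splits)
  then show "x = x' \<and> y = y'" using c[of "y + 1"] by (auto simp: of_bool_def split: if_splits)
qed

text \<open>The conjugate part with index \<open>x\<close> drops by one, as
  \<open>x \<noteq> y + 1\<close>.\<close>

lemma transfer_neq:
  assumes "0 \<notin># p" "(x, y) \<in> transfer_pairs p"
  shows "transfer p x y \<noteq> p"
proof
  assume "transfer p x y = p"
  moreover have "0 < x" using assms by (auto simp: transfer_pairs_def intro: gr0I)
  ultimately show False
    using conjugate_transfer[OF assms(1), of x y x] assms(2)
    by (auto simp: transfer_pairs_def)
qed

text \<open>The two parts merely exchange their sizes \<open>y + 1\<close> and \<open>y\<close>; for
  \<open>y = 0\<close> a part 1 is replaced by a new part 1.\<close>

lemma transfer_pred: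
  assumes "0 \<notin># p" "Suc y \<in># p" "y \<in># add_mset 0 (p - {#Suc y#})"
  shows "transfer p (Suc y) y = p"
proof -
  obtain v where v: "p = add_mset (Suc y) v" using assms(2) by (metis mset_add)
  have f: "filter_mset ((<) 0) p = p" using assms(1) by (auto simp: filter_mset_eq_conv intro: gr0I)
  show ?thesis
  proof (cases "y = 0")
    case True
    then have "v - {#y#} = v" using assms(1) by (simp add: v diff_single_trivial)
    then show ?thesis using f True by (simp add: transfer_def v)
  next
    case False
    then obtain w where "v = add_mset y w" using assms(3) v
      by (metis add_mset_remove_trivial insert_iff mset_add set_mset_add_mset_insert)
    then show ?thesis using f by (simp add: transfer_def v add_mset_commute)
  qed
qed

text \<open>Transfers are reversible, so every neighbour is the result of a transfer from
  \<open>p\<close>, and by injectivity of exactly one pair.\<close>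

lemma partition_degree_eq_card:
  assumes "p \<in> partitions n"
  shows "partition_degree n p = card (transfer_pairs p)"
proof -
  have p0: "0 \<notin># p" using assms by (simp add: partitions_def)
  have "out_arcs (with_proj (partition_graph n)) p
      = (\<lambda>(x, y). (p, transfer p x y)) ` transfer_pairs p" (is "?A = ?B")
  proof (intro equalityI subsetI)
    fix e assume "e \<in> ?A"
    then obtain r where e: "e = (p, r)" and r: "r \<in> partitions n" "p \<noteq> r"
      "is_transfer p r \<or> is_transfer r p"
      by (auto simp: out_arcs_def partition_graph_def)
    then have "is_transfer p r" using is_transfer_sym by (auto simp: partitions_def)
    then obtain x y where "x \<in># p" "y \<in># add_mset 0 (p - {#x#})" "r = transfer p x y"
      unfolding is_transfer_def by blast
    moreover from this have "x \<noteq> y + 1" using transfer_pred[OF p0, of y] r(2) by auto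
    ultimately show "e \<in> ?B" by (auto simp: e transfer_pairs_def)
  next
    fix e assume "e \<in> ?B"
    then obtain x y where xy: "(x, y) \<in> transfer_pairs p" and e: "e = (p, transfer p x y)" by auto
    then have "is_transfer p (transfer p x y)" by (auto simp: is_transfer_def transfer_pairs_def)
    then show "e \<in> ?A"
      using is_transfer_partitions[OF assms] transfer_neq[OF p0 xy] assms
      by (auto simp: out_arcs_def partition_graph_def e)
  qed
  moreover have "inj_on (\<lambda>(x, y). (p, transfer p x y)) (transfer_pairs p)"
    using inj_on_transfer[OF p0] by (auto simp: inj_on_def)
  ultimately show ?thesis by (simp add: partition_degree_def out_degree_def card_image)
qed

text \<open>The element 0 is inserted because a zero part can receive; thus 1 is never a gap. Taking
  a set as argument lets the sum bound below serve for the repeated sizes too.\<close>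

definition gaps :: "nat set \<Rightarrow> nat set" where
  "gaps D = {x \<in> D. x - 1 \<notin> insert 0 D}"

definition repeated :: "nat multiset \<Rightarrow> nat set" where
  "repeated p = {x \<in> set_mset p. 2 \<le> count p x}"

lemma gaps_subset: "gaps D \<subseteq> D"
  by (auto simp: gaps_def)

lemma repeated_subset: "repeated p \<subseteq> set_mset p"
  by (auto simp: repeated_def)

lemma partition_degree_formula:
  assumes "p \<in> partitions n"
  defines "k \<equiv> card (set_mset p)"
  shows "partition_degree n p = k * (k - 1) + card (gaps (set_mset p)) + card (repeated p)"
proof -
  define D where "D = set_mset p"
  have D0: "0 \<notin> D" and fin: "finite D" using assms by (auto simp: D_def partitions_def)
  let ?A = "(\<lambda>x. (x, x - 1)) ` (D - gaps D)"
  let ?B = "(\<lambda>x. (x, x)) ` (D - repeated p)"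
  \<comment> \<open>Taking away one copy of \<open>x\<close> matters only for the receiver
    \<open>y = x\<close>, which then needs a second copy.\<close>
  have mem: "y \<in># add_mset 0 (p - {#x#}) \<longleftrightarrow> y \<in> insert 0 D \<and> (x = y \<longrightarrow> x \<in> repeated p)"
    if "x \<in> D" for x y
    using that D0 by (auto simp: D_def repeated_def in_diff_count numeral_2_eq_2 Suc_le_eq count_eq_zero_iff)
  have S: "transfer_pairs p = D \<times> insert 0 D - (?A \<union> ?B)"
  proof (intro set_eqI, clarify)
    fix x y
    show "(x, y) \<in> transfer_pairs p \<longleftrightarrow> (x, y) \<in> D \<times> insert 0 D - (?A \<union> ?B)"
    proof (cases "x \<in> D")
      case True
      then have "x \<noteq> 0" using D0 by metis
      have "(x, y) \<in> transfer_pairs p \<longleftrightarrow> y \<in> insert 0 D \<and> (x = y \<longrightarrow> x \<in> repeated p) \<and> x \<noteq> y + 1"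
        using mem[OF True] True by (auto simp: transfer_pairs_def D_def)
      also have "\<dots> \<longleftrightarrow> (x, y) \<in> D \<times> insert 0 D - (?A \<union> ?B)"
        using True \<open>x \<noteq> 0\<close> by (auto simp: gaps_def)
      finally show ?thesis .
    next
      case False
      then show ?thesis by (auto simp: transfer_pairs_def D_def)
    qed
  qed
  have sub: "?A \<union> ?B \<subseteq> D \<times> insert 0 D" by (auto simp: gaps_def)
  have disj: "?A \<inter> ?B = {}"
  proof (rule ccontr)
    assume "?A \<inter> ?B \<noteq> {}"
    then obtain x where "x \<in> D" "x - 1 = x" by auto
    then show False using D0 by (cases x) auto
  qed
  have kD: "k = card D" by (simp add: k_def D_def)
  have cG: "card (D - gaps D) = k - card (gaps D)"
    using fin gaps_subset[of D] by (simp add: kD card_Diff_subset finite_subset)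
  have cR: "card (D - repeated p) = k - card (repeated p)"
    using repeated_subset[of p] by (simp add: kD D_def card_Diff_subset finite_subset)
  have "card (transfer_pairs p) = card (D \<times> insert 0 D) - card (?A \<union> ?B)"
    unfolding S using fin sub by (intro card_Diff_subset) auto
  also have "card (?A \<union> ?B) = (k - card (gaps D)) + (k - card (repeated p))"
    using fin disj by (subst card_Un_disjoint) (auto simp: card_image inj_on_def cG cR)
  also have "card (D \<times> insert 0 D) = k * (k + 1)"
    using fin D0 by (simp add: kD)
  finally have "partition_degree n p = k * (k + 1) - ((k - card (gaps D)) + (k - card (repeated p)))"
    using partition_degree_eq_card[OF assms(1)] by simp
  moreover have "card (gaps D) \<le> k" "card (repeated p) \<le> k"
    using fin gaps_subset repeated_subset by (auto simp: kD D_def intro!: card_mono)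
  moreover have "k * (k + 1) = k * (k - 1) + k + k" by (cases k) auto
  ultimately show ?thesis by (simp add: D_def)
qed

section \<open>The upper bound\<close>

lemma mono_triangle: "mono triangle"
  by (rule incseq_SucI) simp

lemma le_triangle: "m \<le> triangle m"
  by (induction m) auto

text \<open>Induction adding the largest element \<open>m\<close>. The elements and the predecessors
  of gaps are disjoint subsets of \<open>{1..m}\<close>, so the new cardinality plus the new number
  of gaps is at most \<open>m\<close>. This bounds the growth of the left side by that of the
  sum.\<close>

lemma triangle_card_add_le_sum:
  assumes "finite D" "0 \<notin> D"
  shows "triangle (card D) + triangle (card (gaps D)) \<le> \<Sum>D"
  using assms
proof (induction D rule: finite_linorder_max_induct)
  case empty
  then show ?case by (simp add: gaps_def)
next
  case (insert m D)
  have m: "m \<notin> D" "0 < m" using insert by auto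
  have "card (insert m D) + card ((\<lambda>x. x - 1) ` gaps (insert m D))
      = card (insert m D \<union> (\<lambda>x. x - 1) ` gaps (insert m D))"
    using insert(1) finite_subset[OF gaps_subset, of "insert m D"]
    by (subst card_Un_disjoint) (auto simp: gaps_def)
  also have "\<dots> \<le> card {1..m}"
  proof (intro card_mono subsetI)
    fix y assume "y \<in> insert m D \<union> (\<lambda>x. x - 1) ` gaps (insert m D)"
    then show "y \<in> {1..m}" using insert(2,4) by (fastforce simp: gaps_def Suc_le_eq)
  qed simp
  also have "card ((\<lambda>x. x - 1) ` gaps (insert m D)) = card (gaps (insert m D))"
    by (rule card_image) (auto simp: gaps_def inj_on_def)
  finally have le: "card (insert m D) + card (gaps (insert m D)) \<le> m" by simp
  \<comment> \<open>As \<open>m\<close> exceeds all of \<open>D\<close>, it is no predecessor of an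
    old element, so old gaps persist.\<close>
  have g: "gaps (insert m D) = (if m - 1 \<in> insert 0 D then gaps D else insert m (gaps D))"
    using insert(2) m by (auto simp: gaps_def)
  have "m \<notin> gaps D" using gaps_subset m by blast
  moreover have "finite (gaps D)" using insert(1) gaps_subset finite_subset by blast
  ultimately have "triangle (card (insert m D)) + triangle (card (gaps (insert m D))) \<le>
      triangle (card D) + triangle (card (gaps D)) + m"
    using le m insert(1) by (auto simp: g split: if_splits)
  also have "\<dots> \<le> \<Sum>(insert m D)" using insert m by simp
  finally show ?case .
qed

lemma sum_mset_eq_sum_count:
  fixes p :: "nat multiset"
  shows "sum_mset p = (\<Sum>x\<in>set_mset p. count p x * x)"
proof (induction p)
  case (add y p)
  have "(\<Sum>x\<in>set_mset (add_mset y p). count (add_mset y p) x * x)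
      = (\<Sum>x\<in>insert y (set_mset p). count p x * x + (if x = y then y else 0))"
    by (intro sum.cong) auto
  also have "\<dots> = (\<Sum>x\<in>insert y (set_mset p). count p x * x) + y"
    by (simp add: sum.distrib)
  also have "(\<Sum>x\<in>insert y (set_mset p). count p x * x) = (\<Sum>x\<in>set_mset p. count p x * x)"
    by (rule sum.mono_neutral_right) (auto simp: not_in_iff)
  finally show ?case using add by simp
qed simp

text \<open>Each size occurs once and each repeated size at least once more. The sum bound applies
  to both sets; for the repeated sizes its gap term is dropped.\<close>

lemma triangle_distinct_gaps_repeated:
  assumes "p \<in> partitions n"
  shows "triangle (card (set_mset p)) + triangle (card (gaps (set_mset p)))
    + triangle (card (repeated p)) \<le> n"
proof -
  have "0 \<notin> repeated p" using assms repeated_subset[of p] by (auto simp: partitions_def)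
  then have "triangle (card (repeated p)) \<le> \<Sum>(repeated p)"
    using triangle_card_add_le_sum[of "repeated p"] finite_subset[OF repeated_subset, of p] by simp
  moreover have "triangle (card (set_mset p)) + triangle (card (gaps (set_mset p))) \<le> \<Sum>(set_mset p)"
    using assms by (intro triangle_card_add_le_sum) (auto simp: partitions_def)
  moreover have "\<Sum>(set_mset p) + \<Sum>(repeated p) \<le> n"
  proof -
    have "\<Sum>(repeated p) = (\<Sum>x\<in>set_mset p. if x \<in> repeated p then x else 0)"
      using repeated_subset by (simp add: sum.If_cases Int_absorb1)
    then have "\<Sum>(set_mset p) + \<Sum>(repeated p)
        = (\<Sum>x\<in>set_mset p. x + (if x \<in> repeated p then x else 0))"
      by (simp add: sum.distrib)
    also have "\<dots> \<le> (\<Sum>x\<in>set_mset p. count p x * x)"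
    proof (rule sum_mono)
      fix x assume "x \<in># p"
      then have "1 \<le> count p x" by simp
      then have "1 * x \<le> count p x * x" by (rule mult_le_mono1)
      moreover have "2 * x \<le> count p x * x" if "x \<in> repeated p"
        using that by (intro mult_le_mono1) (simp add: repeated_def)
      ultimately show "x + (if x \<in> repeated p then x else 0) \<le> count p x * x"
        by (simp add: mult_2)
    qed
    also have "\<dots> = n"
      using assms by (simp add: partitions_def sum_mset_eq_sum_count)
    finally show ?thesis .
  qed
  ultimately show ?thesis by linarith
qed

lemma rho_ge:
  assumes "triangle a + triangle b \<le> q"
  shows "a + b \<le> rho q"
  unfolding rho_def using assms by (intro Max_ge finite_rho) auto

lemma rho_witness: "\<exists>a b. triangle a + triangle b \<le> q \<and> rho q = a + b"
proof -
  have "0 \<in> {a + b | a b. triangle a + triangle b \<le> q}"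
    by (metis (mono_tags, lifting) add_0 mem_Collect_eq triangle_0 zero_le)
  then have "rho q \<in> {a + b | a b. triangle a + triangle b \<le> q}"
    unfolding rho_def by (intro Max_in finite_rho) blast+
  then show ?thesis by auto
qed

lemma partition_degree_le:
  assumes "q \<le> s" "p \<in> partitions (triangle s + q)"
  shows "partition_degree (triangle s + q) p \<le> s * (s - 1) + rho q"
proof -
  define k a b where "k = card (set_mset p)" and "a = card (gaps (set_mset p))"
    and "b = card (repeated p)"
  have deg: "partition_degree (triangle s + q) p = k * (k - 1) + a + b"
    using partition_degree_formula[OF assms(2)] by (simp add: k_def a_def b_def)
  have T: "triangle k + triangle a + triangle b \<le> triangle s + q"
    using triangle_distinct_gaps_repeated[OF assms(2)] by (simp add: k_def a_def b_def)
  have ab: "a \<le> k" "b \<le> k"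
    unfolding a_def b_def k_def using gaps_subset repeated_subset by (auto intro!: card_mono)
  \<comment> \<open>Otherwise \<open>triangle k\<close> would be at least
    \<open>triangle s + s + 1\<close>, which exceeds \<open>triangle s + q\<close>.\<close>
  have "\<not> Suc s \<le> k"
    using monoD[OF mono_triangle, of "Suc s" k] T assms(1) by auto
  then consider "k = s" | "Suc k \<le> s" by linarith
  then show ?thesis
  proof cases
    case 1
    then show ?thesis using rho_ge[of a b q] T deg by simp
  next
    case 2
    have "partition_degree (triangle s + q) p \<le> k * (k - 1) + k + k" using deg ab by linarith
    also have "\<dots> = Suc k * k" by (cases k) auto
    also have "\<dots> \<le> s * (s - 1)" using 2 by (intro mult_mono) auto
    finally show ?thesis by simp
  qed
qed

section \<open>A partition of maximal degree\<close>

text \<open>Truncated subtraction kills the first \<open>m\<close> terms. The sum is the cost of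
  opening gaps below the top \<open>a\<close> of \<open>m + a\<close> consecutive parts.\<close>

lemma sum_diff_triangle: "(\<Sum>i = 1..m + a. i - m) = triangle a"
  by (induction a) auto

lemma sum_triangle: "\<Sum>{1..m} = triangle m"
  by (induction m) auto

text \<open>The distinct parts \<open>1, \<dots>, m, m + 2, m + 4, \<dots>, m + 2a\<close> have \<open>a\<close> gaps; the parts
  \<open>1, \<dots>, b\<close> are repeated, and further parts \<open>1\<close> fill up the sum.\<close>

lemma partition_degree_ge:
  assumes "q \<le> s" "triangle a + triangle b \<le> q"
  shows "\<exists>p \<in> partitions (triangle s + q). s * (s - 1) + (a + b) \<le> partition_degree (triangle s + q) p"
proof -
  define c where "c = q - (triangle a + triangle b)"
  define m where "m = s - a"
  define f where "f i = i + (i - m)" for i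
  define D where "D = f ` {1..s}"
  define p where "p = mset_set D + mset_set {1..b} + replicate_mset c 1"
  have ab: "a + b \<le> s" using assms le_triangle[of a] le_triangle[of b] by linarith
  have s: "s = m + a" using ab by (simp add: m_def)
  \<comment> \<open>Filling with ones must not create a new size, so 1 has to be in \<open>D\<close>
    if \<open>c > 0\<close>. For \<open>m = 0\<close> we have \<open>a = s\<close>, and
    \<open>q \<le> s \<le> triangle a\<close> leaves nothing to fill.\<close>
  have c0: "m = 0 \<Longrightarrow> c = 0" using assms le_triangle[of a] by (simp add: c_def s)
  have inj: "inj_on f X" for X by (auto simp: inj_on_def f_def)
  have fin: "finite D" by (simp add: D_def)
  have low: "i \<in> D" if "1 \<le> i" "i \<le> m" for i
    using that s unfolding D_def by (intro image_eqI[of _ _ i]) (auto simp: f_def)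
  have bD: "{1..b} \<subseteq> D" using low ab s by auto
  have set_p: "set_mset p = D"
    using fin bD low[of 1] c0 by (cases "c = 0") (auto simp: p_def Suc_le_eq)
  have "\<Sum>D = (\<Sum>i = 1..s. f i)" unfolding D_def by (simp add: sum.reindex[OF inj])
  also have "\<dots> = triangle s + triangle a"
    using sum_diff_triangle[of m a] sum_triangle[of s] by (simp add: f_def sum.distrib s)
  finally have "sum_mset p = triangle s + q"
    using assms(2) sum_triangle[of b]
    by (simp add: p_def c_def sum_unfold_sum_mset)
  moreover have "0 \<notin> D" by (auto simp: D_def f_def)
  ultimately have p: "p \<in> partitions (triangle s + q)" by (simp add: partitions_def set_p)
  have k: "card D = s" unfolding D_def by (simp add: card_image[OF inj])
  have "f ` {m + 1..s} \<subseteq> gaps D"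
  proof
    fix x assume "x \<in> f ` {m + 1..s}"
    then obtain i where i: "m + 1 \<le> i" "i \<le> s" "x = f i" by auto
    \<comment> \<open>For \<open>j \<le> m\<close> the value \<open>f j\<close> is at most
      \<open>m\<close>, below \<open>x - 1\<close>; for \<open>j > m\<close> the values
      \<open>f j\<close> and \<open>f i\<close> have the same parity.\<close>
    have "x - 1 \<noteq> f j" for j
    proof (cases "j \<le> m")
      case True
      then show ?thesis using i by (simp add: f_def)
    next
      case False
      then have "f j + m = 2 * j" "f i + m = 2 * i" using i by (simp_all add: f_def)
      then show ?thesis using i(1,3) by presburger
    qed
    then have "x - 1 \<notin> D" unfolding D_def by blast
    moreover have "x \<in> D" unfolding D_def i(3) using i by (intro imageI) simp
    moreover have "x - 1 \<noteq> 0" using i by (simp add: f_def)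
    ultimately show "x \<in> gaps D" by (simp add: gaps_def)
  qed
  then have "card (f ` {m + 1..s}) \<le> card (gaps D)"
    by (rule card_mono[OF finite_subset[OF gaps_subset fin]])
  then have a: "a \<le> card (gaps D)" by (simp add: card_image[OF inj] s)
  \<comment> \<open>Only an inclusion: for \<open>b = 0\<close> the filling ones may make 1
    repeated.\<close>
  have "{1..b} \<subseteq> repeated p"
    using bD fin set_p by (auto simp: repeated_def p_def subset_iff)
  then have "card {1..b} \<le> card (repeated p)"
    by (rule card_mono[OF finite_subset[OF repeated_subset finite_set_mset]])
  then have "b \<le> card (repeated p)" by simp
  then show ?thesis
    using a p partition_degree_formula[OF p] by (intro bexI[of _ p]) (auto simp: set_p k)
qed

section \<open>The closed form of rho\<close>

lemma double_triangle: "2 * triangle m = m * (m + 1)"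
  by (induction m) auto

text \<open>For \<open>m = a + b\<close> we have \<open>4 (triangle a + triangle b) + 1 = (m + 1)\<^sup>2 + (a - b)\<^sup>2\<close>, so
  balanced \<open>a\<close> and \<open>b\<close> are optimal.\<close>

lemma rho_eq_floor_sqrt: "int (rho q) = \<lfloor>sqrt (4 * real q + 1)\<rfloor> - 1"
proof -
  obtain a b where ab: "triangle a + triangle b \<le> q" "rho q = a + b" using rho_witness by blast
  have ident: "4 * (int (triangle a) + int (triangle b)) + 1 = (int a + int b + 1)\<^sup>2 + (int a - int b)\<^sup>2"
    for a b
  proof -
    have "2 * int (triangle m) = int m * (int m + 1)" for m
      using arg_cong[OF double_triangle[of m], of int] by (simp add: algebra_simps)
    from this[of a] this[of b] show ?thesis by (simp add: power2_eq_square algebra_simps)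
  qed
  have up: "(int (rho q) + 1)\<^sup>2 \<le> 4 * int q + 1"
  proof -
    have "(int a + int b + 1)\<^sup>2 \<le> (int a + int b + 1)\<^sup>2 + (int a - int b)\<^sup>2" by simp
    also have "\<dots> = 4 * (int (triangle a) + int (triangle b)) + 1" by (rule ident[symmetric])
    also have "\<dots> \<le> 4 * int q + 1"
      using ab(1) by (simp flip: of_nat_add)
    finally show ?thesis by (simp add: ab(2))
  qed
  have low: "4 * int q + 1 < (int (rho q) + 2)\<^sup>2"
  proof (rule ccontr)
    assume neg: "\<not> ?thesis"
    define m where "m = rho q + 1"
    have le: "(int m + 1)\<^sup>2 \<le> 4 * int q + 1" using neg by (simp add: m_def add.commute)
    \<comment> \<open>Split \<open>m\<close> into halves. For odd \<open>m\<close> they differ by 1,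
      and \<open>ident\<close> gives \<open>(m + 1)\<^sup>2\<close> as four times the sum of
      triangles; this is at most \<open>4 * q + 1\<close>, so integrality yields the bound
      \<open>q\<close>.\<close>
    have "triangle ((m + 1) div 2) + triangle (m div 2) \<le> q"
    proof (cases "even m")
      case True
      then obtain j where "m = 2 * j" by blast
      then show ?thesis using ident[of j j] le by simp
    next
      case False
      then obtain j where j: "m = 2 * j + 1" by (metis oddE)
      then show ?thesis using ident[of "j + 1" j] le by (simp add: power2_eq_square algebra_simps)
    qed
    then have "(m + 1) div 2 + m div 2 \<le> rho q" by (rule rho_ge)
    then show False by (simp add: m_def)
  qed
  have "\<lfloor>sqrt (4 * real q + 1)\<rfloor> = int (rho q) + 1"
  proof (rule floor_unique)
    have "real_of_int ((int (rho q) + 1)\<^sup>2) \<le> real_of_int (4 * int q + 1)"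
      using up by (simp only: of_int_le_iff)
    then show "real_of_int (int (rho q) + 1) \<le> sqrt (4 * real q + 1)"
      by (intro real_le_rsqrt) simp
    have "real_of_int (4 * int q + 1) < real_of_int ((int (rho q) + 2)\<^sup>2)"
      using low by (simp only: of_int_less_iff)
    then show "sqrt (4 * real q + 1) < real_of_int (int (rho q) + 1) + 1"
      by (intro real_less_lsqrt) (simp_all add: add.commute)
  qed
  then show ?thesis by simp
qed

theorem theorem3p7:
  fixes s q n :: nat
  assumes "1 \<le> s" and "q \<le> s" and "n = triangle s + q"
  shows "max_degree n = s * (s - 1) + rho q \<and>
    int (max_degree n) = int s * (int s - 1) + \<lfloor>sqrt (4 * real q + 1)\<rfloor> - 1"
proof -
  obtain a b where ab: "triangle a + triangle b \<le> q" "rho q = a + b" using rho_witness by blast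
  obtain p where p: "p \<in> partitions n" "s * (s - 1) + rho q \<le> partition_degree n p"
    using partition_degree_ge[OF assms(2) ab(1)] assms(3) ab(2) by auto
  have le: "partition_degree n r \<le> s * (s - 1) + rho q" if "r \<in> partitions n" for r
    using partition_degree_le[OF assms(2)] that assms(3) by simp
  have "max_degree n = s * (s - 1) + rho q"
    unfolding max_degree_def
  proof (rule Max_eqI)
    show "s * (s - 1) + rho q \<in> partition_degree n ` partitions n"
      using p le[OF p(1)] by (intro image_eqI[of _ _ p]) auto
  qed (use le finite_partitions in auto)
  \<comment> \<open>With \<open>1 \<le> s\<close> the natural number \<open>s - 1\<close> agrees
    with the integer difference.\<close>
  then show ?thesis using rho_eq_floor_sqrt[of q] assms(1) by (simp add: of_nat_diff)
qed

end
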